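(* Let $(L_n)_{n\ge1}$ and $(T_m)_{m\ge1}$ be two sequences of positive linear operators such that $$\lim_{n\to\infty}L_{mn}\left(f(nt);\frac{x}{n}\right)=T_m(f(t);x)$$ for all $m\ge1$, $x\ge0$, $f\in C_b[0,\infty)$. Then $$T_{m\nu}\left(f(\nu t);\frac{x}{\nu}\right)=T_m(f(t);x)$$ for all integers $m\ge1$, $\nu\ge1$, and all $x\ge0$, $f\in C_b[0,\infty)$.
   Context: $C_b[0,\infty)$ is the space of real-valued continuous bounded functions on $[0,\infty)$. The operators $T_m$ map $C_b[0,\infty)$ to real functions on $[0,\infty)$; the operators $L_n$ map $C_b(J)$ to real functions on $J$, where $J=[0,\infty)$ or $J=[0,d]$ for some $d>0$. The notation $L_{mn}(f(nt);x/n)$ means: apply $L_{mn}$ to the function $t\mapsto f(nt)$ (restricted to $J$) and evaluate at $x/n$ (which lies in $J$ for all large $n$); similarly $T_{m\nu}(f(\nu t);x/\nu)$ is $T_{m\nu}$ applied to $t\mapsto f(\nu t)$, evaluated at $x/\nu$. *)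

theory Defs
  imports "HOL-Analysis.Analysis"
begin

text \<open>
  Real functions on a set \<open>J\<close> are represented by the elements of \<^term>\<open>extensional J\<close>, so that
  two of them are equal exactly if they agree on \<open>J\<close>.
\<close>

definition Cb :: "real set \<Rightarrow> (real \<Rightarrow> real) set" where
  "Cb J = {f \<in> extensional J. continuous_on J f \<and> bounded (f ` J)}"

definition positive_linear_operator ::
    "real set \<Rightarrow> ((real \<Rightarrow> real) \<Rightarrow> real \<Rightarrow> real) \<Rightarrow> bool" where
  "positive_linear_operator J A \<longleftrightarrow>
     A \<in> Cb J \<rightarrow> extensional J \<and>
     (\<forall>f\<in>Cb J. \<forall>g\<in>Cb J. \<forall>x\<in>J. A (\<lambda>t\<in>J. f t + g t) x = A f x + A g x) \<and>
     (\<forall>c. \<forall>f\<in>Cb J. \<forall>x\<in>J. A (\<lambda>t\<in>J. c * f t) x = c * A f x) \<and>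
     (\<forall>f\<in>Cb J. (\<forall>t\<in>J. 0 \<le> f t) \<longrightarrow> (\<forall>x\<in>J. 0 \<le> A f x))"

end

theory Submission
  imports Defs
begin

text \<open>
  Both sides are limits of the same expressions \<open>L\<^bsub>k\<^esub>(f(k t / m); m x / k)\<close>.
  The hypothesis for the index \<open>m\<close> gives \<open>T\<^bsub>m\<^esub>(f; x)\<close> as the limit along the multiples
  \<open>k\<close> of \<open>m\<close>. For the index \<open>m \<nu>\<close>, the function \<open>f(\<nu> t)\<close> and the point \<open>x / \<nu>\<close>, the
  two factors \<open>\<nu>\<close> are absorbed, and the hypothesis gives the left-hand side as the limit along
  the multiples \<open>k\<close> of \<open>m \<nu>\<close>. That is a subsequence, so the two limits agree.
\<close>

lemma Cb_dilation:
  assumes f: "f \<in> Cb {0..}" and c: "0 \<le> c"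
  shows "(\<lambda>t\<in>{0..}. f (c * t)) \<in> Cb {0..}"
proof -
  have sub: "(\<lambda>t. c * t) ` {0..} \<subseteq> {0..}"
    using c by auto
  have "continuous_on {0..} (\<lambda>t. f (c * t))"
  proof (rule continuous_on_compose2[OF _ _ sub])
    show "continuous_on {0..} f"
      using f by (simp add: Cb_def)
    show "continuous_on {0..} (\<lambda>t. c * t)"
      by (intro continuous_intros)
  qed
  moreover have "bounded ((\<lambda>t\<in>{0..}. f (c * t)) ` {0..})"
  proof (rule bounded_subset)
    show "bounded (f ` {0..})"
      using f by (simp add: Cb_def)
    show "(\<lambda>t\<in>{0..}. f (c * t)) ` {0..} \<subseteq> f ` {0..}"
      using c by auto
  qed
  ultimately show ?thesis
    by (simp add: Cb_def cong: continuous_on_cong_simp)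
qed

theorem proposition12p1:
  fixes J :: "real set"
    and L T :: "nat \<Rightarrow> (real \<Rightarrow> real) \<Rightarrow> real \<Rightarrow> real"
  assumes J: "J = {0..} \<or> (\<exists>d>0. J = {0..d})"
    and L: "\<And>n. n \<ge> 1 \<Longrightarrow> positive_linear_operator J (L n)"
    and T: "\<And>m. m \<ge> 1 \<Longrightarrow> positive_linear_operator {0..} (T m)"
    and lim: "\<And>m x f. m \<ge> 1 \<Longrightarrow> x \<ge> 0 \<Longrightarrow> f \<in> Cb {0..} \<Longrightarrow>
      (\<lambda>n. L (m * n) (\<lambda>t\<in>J. f (real n * t)) (x / real n)) \<longlonglongrightarrow> T m f x"
  shows "\<forall>m\<ge>1. \<forall>\<nu>\<ge>1. \<forall>x\<ge>0. \<forall>f\<in>Cb {0..}.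
    T (m * \<nu>) (\<lambda>t\<in>{0..}. f (real \<nu> * t)) (x / real \<nu>) = T m f x"
proof (intro allI impI ballI)
  fix m \<nu> :: nat and x :: real and f :: "real \<Rightarrow> real"
  assume m: "1 \<le> m" and nu: "1 \<le> \<nu>" and x: "0 \<le> x" and f: "f \<in> Cb {0..}"
  define g where "g = (\<lambda>t\<in>{0..}. f (real \<nu> * t))"
  have "g \<in> Cb {0..}"
    unfolding g_def using f by (rule Cb_dilation) simp
  then have lim_g: "(\<lambda>n. L (m * \<nu> * n) (\<lambda>t\<in>J. g (real n * t)) (x / real \<nu> / real n))
      \<longlonglongrightarrow> T (m * \<nu>) g (x / real \<nu>)"
    using m nu x by (intro lim) auto
  have "strict_mono (\<lambda>n. \<nu> * n)"
    using nu by (simp add: strict_mono_def)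
  from LIMSEQ_subseq_LIMSEQ[OF lim[OF m x f] this]
  have lim_f: "(\<lambda>n. L (m * (\<nu> * n)) (\<lambda>t\<in>J. f (real (\<nu> * n) * t)) (x / real (\<nu> * n)))
      \<longlonglongrightarrow> T m f x"
    by (simp add: o_def)
  \<comment> \<open>\<open>g\<close> is only prescribed on \<open>[0, \<infinity>)\<close>, so this uses that \<open>J\<close> has no negative elements.\<close>
  have "(\<lambda>t\<in>J. g (real n * t)) = (\<lambda>t\<in>J. f (real (\<nu> * n) * t))" for n
    using J by (intro restrict_ext) (auto simp: g_def mult.assoc)
  with lim_g have "(\<lambda>n. L (m * (\<nu> * n)) (\<lambda>t\<in>J. f (real (\<nu> * n) * t)) (x / real (\<nu> * n)))
      \<longlonglongrightarrow> T (m * \<nu>) g (x / real \<nu>)"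
    by (simp add: mult.assoc)
  then show "T (m * \<nu>) (\<lambda>t\<in>{0..}. f (real \<nu> * t)) (x / real \<nu>) = T m f x"
    using lim_f unfolding g_def by (rule LIMSEQ_unique)
qed

end
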